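(* Let $k\ge 0$ be an integer. Let $\mathbf{A}_k(x)$ be the exponential generating function (in the number $n$ of vertices) for the total number of balanced vertices of rank $k$ in all plane 1-2 trees on $[n]$, let $\mathbf{R}_k(x)$ be the exponential generating function for the number of plane 1-2 trees on $[n]$ in which the root is balanced and of rank $k$, and let $Z(x)=\sum_{n\ge 0}z_n\frac{x^n}{n!}$ be the exponential generating function for the number $z_n$ of plane 1-2 trees on $[n]$, with $z_0=1$. Then the differential equation $$\mathbf{A}_k'(x)=2\mathbf{A}_k(x)Z(x)-\mathbf{A}_k(x)+\mathbf{R}_k'(x)$$ holds, with the initial condition $\mathbf{A}_k(0)=0$.
   Context: A plane 1-2 tree on vertex set $[n]=\{1,\dots,n\}$ is a rooted tree whose vertices are bijectively labeled by $[n]$, in which every vertex has a smaller label than its parent, every non-leaf vertex has one or two children, and the children of each vertex are linearly ordered left to right (an only child has no direction: it is neither a left child nor a right child). A leaf is a vertex with no children. A vertex $v$ of a rooted tree is called balanced if all descending paths from $v$ to a leaf have the same length (number of edges); that common length is the rank of $v$. In particular leaves are balanced, of rank $0$. The exponential generating function of a sequence $(s_n)$ is $\sum_{n\ge0}s_n\frac{x^n}{n!}$; for $n=0$ there are no vertices and no root, so the constant terms of $\mathbf{A}_k$ and $\mathbf{R}_k$ are $0$. *)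

theory Defs
  imports "HOL-Computational_Algebra.Formal_Power_Series"
begin

text \<open>
  Rooted trees with natural-number labels in which every vertex has no child, a single
  child without direction, or a left and a right child.
\<close>

datatype tree12 =
    Leaf nat
  | Unary nat tree12
  | Binary nat tree12 tree12

primrec root_label :: "tree12 \<Rightarrow> nat" where
  "root_label (Leaf a) = a"
| "root_label (Unary a s) = a"
| "root_label (Binary a l r) = a"

text \<open>
  A vertex is represented by the subtree consisting of it and its descendants. The subtrees
  are listed, rather than collected in a set, so that every vertex gives exactly one entry.
\<close>

primrec vertices :: "tree12 \<Rightarrow> tree12 list" where
  "vertices (Leaf a) = [Leaf a]"
| "vertices (Unary a s) = Unary a s # vertices s"
| "vertices (Binary a l r) = Binary a l r # vertices l @ vertices r"

definition labels :: "tree12 \<Rightarrow> nat list" where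
  "labels t = map root_label (vertices t)"

primrec decreasing :: "tree12 \<Rightarrow> bool" where
  "decreasing (Leaf a) \<longleftrightarrow> True"
| "decreasing (Unary a s) \<longleftrightarrow> root_label s < a \<and> decreasing s"
| "decreasing (Binary a l r) \<longleftrightarrow>
     root_label l < a \<and> root_label r < a \<and> decreasing l \<and> decreasing r"

definition plane12_trees :: "nat \<Rightarrow> tree12 set" where
  "plane12_trees n =
     {t. decreasing t \<and> distinct (labels t) \<and> set (labels t) = {1..n}}"

text \<open>
  The descending paths from the root to a leaf, each given as the list of the vertices on it.
\<close>

primrec leaf_paths :: "tree12 \<Rightarrow> tree12 list set" where
  "leaf_paths (Leaf a) = {[Leaf a]}"
| "leaf_paths (Unary a s) = (\<lambda>p. Unary a s # p) ` leaf_paths s"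
| "leaf_paths (Binary a l r) = (\<lambda>p. Binary a l r # p) ` (leaf_paths l \<union> leaf_paths r)"

text \<open>The length of a path is its number of edges, one less than its number of vertices.\<close>

definition path_length :: "tree12 list \<Rightarrow> nat" where
  "path_length p = length p - 1"

definition balanced :: "tree12 \<Rightarrow> bool" where
  "balanced v \<longleftrightarrow>
     (\<forall>p\<in>leaf_paths v. \<forall>q\<in>leaf_paths v. path_length p = path_length q)"

text \<open>Only meaningful for balanced vertices.\<close>

definition rank :: "tree12 \<Rightarrow> nat" where
  "rank v = (THE r. \<forall>p\<in>leaf_paths v. path_length p = r)"

lemma leaf_paths_nonempty: "leaf_paths t \<noteq> {}"
  by (induction t) auto

lemma balanced_rank_iff:
  "balanced v \<and> rank v = k \<longleftrightarrow> (\<forall>p\<in>leaf_paths v. path_length p = k)"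
proof -
  obtain p where p: "p \<in> leaf_paths v" using leaf_paths_nonempty by blast
  show ?thesis
  proof
    assume v: "balanced v \<and> rank v = k"
    then have all: "\<forall>q\<in>leaf_paths v. path_length q = path_length p"
      using p unfolding balanced_def by blast
    moreover have "rank v = path_length p"
      unfolding rank_def
    proof (rule the_equality)
      show "\<forall>q\<in>leaf_paths v. path_length q = path_length p" by (rule all)
    next
      fix r assume "\<forall>q\<in>leaf_paths v. path_length q = r"
      then show "r = path_length p" using p by metis
    qed
    ultimately show "\<forall>q\<in>leaf_paths v. path_length q = k" using v by simp
  next
    assume all: "\<forall>q\<in>leaf_paths v. path_length q = k"
    then have "balanced v" unfolding balanced_def by simp
    moreover have "rank v = k"
      unfolding rank_def
    proof (rule the_equality)
      show "\<forall>q\<in>leaf_paths v. path_length q = k" by (rule all)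
    next
      fix r assume "\<forall>q\<in>leaf_paths v. path_length q = r"
      then show "r = k" using p all by metis
    qed
    ultimately show "balanced v \<and> rank v = k" by simp
  qed
qed

definition balanced_count :: "nat \<Rightarrow> tree12 \<Rightarrow> nat" where
  "balanced_count k t = length (filter (\<lambda>v. balanced v \<and> rank v = k) (vertices t))"

text \<open>Finiteness, so that the cardinalities and sums below are the intended ones.\<close>

lemma finite_plane12_trees: "finite (plane12_trees n)"
proof -
  define T where "T m = {t. set (labels t) \<subseteq> {1..n} \<and> length (labels t) \<le> m}" for m
  have "finite (T m)" for m
  proof (induction m)
    case 0
    have "labels t \<noteq> []" for t by (cases t) (simp_all add: labels_def)
    then have "T 0 = {}" by (simp add: T_def)
    then show ?case by simp
  next
    case (Suc m)
    let ?U = "Leaf ` {1..n}" and ?V = "case_prod Unary ` ({1..n} \<times> T m)"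
      and ?W = "(\<lambda>(a, l, r). Binary a l r) ` ({1..n} \<times> T m \<times> T m)"
    have "t \<in> ?U \<union> ?V \<union> ?W" if t: "t \<in> T (Suc m)" for t
    proof (cases t)
      case (Leaf a)
      then have "a \<in> {1..n}" using t by (simp add: T_def labels_def)
      then have "t \<in> ?U" unfolding Leaf by (rule imageI)
      then show ?thesis by (intro UnI1)
    next
      case (Unary a s)
      then have "(a, s) \<in> {1..n} \<times> T m" using t by (simp add: T_def labels_def)
      from imageI[OF this, of "case_prod Unary"] have "t \<in> ?V"
        unfolding Unary prod.case .
      then show ?thesis by (simp only: Un_iff simp_thms)
    next
      case (Binary a l r)
      then have "(a, l, r) \<in> {1..n} \<times> T m \<times> T m"
        using t by (simp add: T_def labels_def image_Un)
      from imageI[OF this, of "\<lambda>(a, l, r). Binary a l r"] have "t \<in> ?W"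
        unfolding Binary prod.case .
      then show ?thesis by (rule UnI2)
    qed
    then have "T (Suc m) \<subseteq> ?U \<union> ?V \<union> ?W" by (rule subsetI)
    moreover have "finite (?U \<union> ?V \<union> ?W)"
      using Suc by (intro finite_UnI finite_imageI finite_cartesian_product finite_atLeastAtMost)
    ultimately show ?case by (rule finite_subset)
  qed
  moreover have "plane12_trees n \<subseteq> T n"
  proof
    fix t assume t: "t \<in> plane12_trees n"
    then have "length (labels t) = card {1..n}"
      unfolding plane12_trees_def mem_Collect_eq by (metis distinct_card)
    with t show "t \<in> T n" by (simp add: T_def plane12_trees_def)
  qed
  ultimately show ?thesis by (rule finite_subset[rotated])
qed

definition egf :: "(nat \<Rightarrow> nat) \<Rightarrow> real fps" where
  "egf s = Abs_fps (\<lambda>n. real (s n) / fact n)"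

definition A_egf :: "nat \<Rightarrow> real fps" where
  "A_egf k = egf (\<lambda>n. \<Sum>t\<in>plane12_trees n. balanced_count k t)"

definition R_egf :: "nat \<Rightarrow> real fps" where
  "R_egf k = egf (\<lambda>n. card {t \<in> plane12_trees n. balanced t \<and> rank t = k})"

text \<open>
  The type of trees has no empty tree, so the convention for the constant term, counting one
  tree on no vertices, is imposed explicitly here.
\<close>

definition Z_egf :: "real fps" where
  "Z_egf = egf (\<lambda>n. if n = 0 then 1 else card (plane12_trees n))"

end

theory Submission
  imports Defs "HOL-Library.Infinite_Set"
begin

text \<open>
  The largest label of a decreasing tree sits at its root. Deleting the root of a tree on
  \<open>{1..n + 1}\<close> therefore leaves nothing (if \<open>n = 0\<close>), one tree on \<open>{1..n}\<close>, or an ordered pair of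
  trees whose label sets are a set \<open>U\<close> and its complement in \<open>{1..n}\<close>; conversely every such
  choice comes from exactly one tree (\<open>sum_plane12_trees_Suc\<close>). The balanced vertices of rank
  \<open>k\<close> in the large tree are those of the smaller trees and possibly the root.

  Whether a vertex is balanced, and of which rank, depends on the shape of the tree only. Since
  order-preserving relabelling identifies the trees on \<open>U\<close> with those on \<open>{1..card U}\<close>, both the
  number of trees on \<open>U\<close> and their total number of balanced vertices of rank \<open>k\<close> depend on
  \<open>card U\<close> only. Write \<open>c n\<close> for the number of trees, \<open>a n\<close> for the total number of balanced
  vertices of rank \<open>k\<close> and \<open>r n\<close> for the number of trees with a balanced root of rank \<open>k\<close>. The two
  subtrees of a binary root contribute equally by symmetry, so that
  \<open>a (n + 1) = r (n + 1) + a n + 2 * (\<Sum>i\<le>n. (n choose i) * a i * c (n - i))\<close>.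
  Here \<open>c 0 = 0\<close> and \<open>a 0 = 0\<close>, so the sets with an empty part contribute nothing. The coefficients
  of \<open>Z\<close> agree with \<open>c\<close> except that the constant term is 1, so the sum formed with \<open>Z\<close> is larger
  by the term \<open>a n\<close> at \<open>i = n\<close>. Expressed through \<open>Z\<close>, the recurrence thus has \<open>a n - 2 * a n\<close>, which
  is the summand \<open>- A\<close> of the differential equation: the product \<open>2 * A * Z\<close> counts the marked vertices
  below a unary root twice, once with a missing left and once with a missing right subtree.
\<close>

section \<open>Relabelling\<close>

definition trees_on :: "nat set \<Rightarrow> tree12 set" where
  "trees_on S = {t. decreasing t \<and> distinct (labels t) \<and> set (labels t) = S}"

lemma plane12_trees_eq: "plane12_trees n = trees_on {1..n}"
  by (simp add: plane12_trees_def trees_on_def)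

primrec relabel :: "(nat \<Rightarrow> nat) \<Rightarrow> tree12 \<Rightarrow> tree12" where
  "relabel f (Leaf a) = Leaf (f a)"
| "relabel f (Unary a s) = Unary (f a) (relabel f s)"
| "relabel f (Binary a l r) = Binary (f a) (relabel f l) (relabel f r)"

lemma labels_simps [simp]:
  "labels (Leaf a) = [a]"
  "labels (Unary a s) = a # labels s"
  "labels (Binary a l r) = a # labels l @ labels r"
  by (simp_all add: labels_def)

lemma root_label_relabel [simp]: "root_label (relabel f t) = f (root_label t)"
  by (cases t) simp_all

lemma labels_relabel [simp]: "labels (relabel f t) = map f (labels t)"
  by (induction t) simp_all

lemma vertices_relabel: "vertices (relabel f t) = map (relabel f) (vertices t)"
  by (induction t) simp_all

lemma root_label_in_labels: "root_label t \<in> set (labels t)"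
  by (cases t) simp_all

lemma decreasing_relabel:
  assumes "strict_mono_on S f" "set (labels t) \<subseteq> S" "decreasing t"
  shows "decreasing (relabel f t)"
  using assms(2,3)
proof (induction t)
  case (Unary a s)
  then show ?case
    using strict_mono_onD[OF assms(1), of "root_label s" a] root_label_in_labels[of s] by auto
next
  case (Binary a l r)
  then show ?case
    using strict_mono_onD[OF assms(1), of "root_label l" a] root_label_in_labels[of l]
      strict_mono_onD[OF assms(1), of "root_label r" a] root_label_in_labels[of r] by auto
qed simp

lemma relabel_inverse:
  assumes "\<And>x. x \<in> set (labels t) \<Longrightarrow> g (f x) = x"
  shows "relabel g (relabel f t) = t"
  using assms by (induction t) simp_all

lemma relabel_in_trees_on:
  assumes "strict_mono_on S f" "t \<in> trees_on S"
  shows "relabel f t \<in> trees_on (f ` S)"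
  using assms decreasing_relabel[OF assms(1), of t] strict_mono_on_imp_inj_on[OF assms(1)]
  by (auto simp: trees_on_def distinct_map)

lemma bij_betw_relabel:
  assumes "strict_mono_on S f"
  shows "bij_betw (relabel f) (trees_on S) (trees_on (f ` S))"
proof (rule bij_betw_byWitness[where f' = "relabel (inv_into S f)"])
  have inj: "inj_on f S" using assms by (rule strict_mono_on_imp_inj_on)
  \<comment> \<open>The inverse is order-preserving as well because labels are linearly ordered.\<close>
  have mono: "strict_mono_on (f ` S) (inv_into S f)"
    using strict_mono_on_less[OF assms]
    by (auto simp: strict_mono_on_def[of "f ` S"] inv_into_f_f[OF inj])
  show "\<forall>t\<in>trees_on S. relabel (inv_into S f) (relabel f t) = t"
    by (auto simp: trees_on_def intro!: relabel_inverse inv_into_f_f[OF inj])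
  show "\<forall>t\<in>trees_on (f ` S). relabel f (relabel (inv_into S f) t) = t"
    by (auto simp: trees_on_def intro!: relabel_inverse f_inv_into_f[of _ f S])
  show "relabel f ` trees_on S \<subseteq> trees_on (f ` S)"
    using relabel_in_trees_on[OF assms] by blast
  have "inv_into S f ` f ` S = S" using inj by simp
  then show "relabel (inv_into S f) ` trees_on (f ` S) \<subseteq> trees_on S"
    using relabel_in_trees_on[OF mono] by fastforce
qed

text \<open>
  The vertices on a path are subtrees and so carry labels; only the lengths of the paths survive
  relabelling, and these determine balance and rank.
\<close>

lemma length_leaf_paths_relabel:
  "length ` leaf_paths (relabel f t) = length ` leaf_paths t"
proof -
  have "(\<lambda>p. length (v # p)) ` X = Suc ` length ` X" for v :: tree12 and X
    by (auto simp: image_image)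
  then have step: "length ` (\<lambda>p. v # p) ` X = Suc ` length ` X" for v :: tree12 and X
    by (simp only: image_image)
  show ?thesis
    by (induction t) (simp_all only: relabel.simps leaf_paths.simps step image_Un
        image_insert image_empty list.size)
qed

lemma balanced_rank_relabel:
  "balanced (relabel f t) \<and> rank (relabel f t) = k \<longleftrightarrow> balanced t \<and> rank t = k"
proof -
  have "balanced v \<and> rank v = k \<longleftrightarrow> (\<forall>m\<in>length ` leaf_paths v. m - 1 = k)" for v
    unfolding balanced_rank_iff path_length_def by simp
  then show ?thesis by (simp only: length_leaf_paths_relabel)
qed

lemma balanced_count_relabel: "balanced_count k (relabel f t) = balanced_count k t"
  by (simp add: balanced_count_def vertices_relabel filter_map o_def balanced_rank_relabel)

text \<open>
  Relabelling along the increasing enumeration of \<open>S\<close>. Through this bijection every sum over the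
  trees on \<open>S\<close> of a quantity that ignores labels depends on the size of \<open>S\<close> only.
\<close>

lemma bij_betw_plane12_trees:
  assumes "finite S"
  obtains f where "bij_betw (relabel f) (plane12_trees (card S)) (trees_on S)"
proof -
  obtain h where h: "bij_betw h {..<card S} S" "strict_mono_on {..<card S} h"
    using ex_bij_betw_strict_mono_card[OF assms] by blast
  \<comment> \<open>The enumeration \<open>h\<close> starts at 0, the labels at 1.\<close>
  let ?f = "\<lambda>i. h (i - 1)"
  have "strict_mono_on {1..card S} ?f"
    by (intro strict_mono_onI strict_mono_onD[OF h(2)]) auto
  moreover have "?f ` {1..card S} = S"
  proof -
    have "(\<lambda>i. i - 1) ` {1..card S} = {..<card S}"
      by (force simp: image_iff intro: bexI[of _ "Suc _"])
    then have "h ` (\<lambda>i. i - 1) ` {1..card S} = S"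
      using bij_betw_imp_surj_on[OF h(1)] by simp
    then show ?thesis by (simp add: image_image)
  qed
  ultimately show thesis
    using bij_betw_relabel[of "{1..card S}" ?f] that by (simp add: plane12_trees_eq)
qed

lemma finite_trees_on: "finite S \<Longrightarrow> finite (trees_on S)"
  using bij_betw_plane12_trees bij_betw_finite finite_plane12_trees by metis

lemma card_trees_on: "finite S \<Longrightarrow> card (trees_on S) = card (plane12_trees (card S))"
  using bij_betw_plane12_trees bij_betw_same_card by metis

lemma sum_balanced_count_trees_on:
  assumes "finite S"
  shows "sum (balanced_count k) (trees_on S) = sum (balanced_count k) (plane12_trees (card S))"
proof -
  obtain f where "bij_betw (relabel f) (plane12_trees (card S)) (trees_on S)"
    using bij_betw_plane12_trees[OF assms] .
  from sum.reindex_bij_betw[OF this, of "balanced_count k"] show ?thesis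
    by (simp add: balanced_count_relabel)
qed

section \<open>Deleting the root\<close>

lemma label_le_root_label:
  "decreasing t \<Longrightarrow> x \<in> set (labels t) \<Longrightarrow> x \<le> root_label t"
  by (induction t) auto

text \<open>
  Comparing the root with every other label, and not with its children only, leaves a condition on
  the subtrees that involves just their label sets.
\<close>

lemma decreasing_iff_less_root:
  "decreasing (Unary a s) \<longleftrightarrow> decreasing s \<and> (\<forall>x\<in>set (labels s). x < a)"
  "decreasing (Binary a l r) \<longleftrightarrow>
     decreasing l \<and> decreasing r \<and> (\<forall>x\<in>set (labels l) \<union> set (labels r). x < a)"
  unfolding decreasing.simps
  by (blast intro: root_label_in_labels le_less_trans[OF label_le_root_label])+

lemma root_label_plane12_trees:
  assumes "t \<in> plane12_trees (Suc n)"
  shows "root_label t = Suc n"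
proof (rule antisym)
  have t: "decreasing t" "set (labels t) = {1..Suc n}"
    using assms by (auto simp: plane12_trees_def)
  show "root_label t \<le> Suc n" using root_label_in_labels[of t] t(2) by simp
  show "Suc n \<le> root_label t" using label_le_root_label[OF t(1)] t(2) by simp
qed

lemma plane12_trees_0 [simp]: "plane12_trees 0 = {}"
proof -
  have "labels t \<noteq> []" for t by (cases t) simp_all
  then show ?thesis by (simp add: plane12_trees_def)
qed

text \<open>
  The root must carry the label \<open>Suc n\<close>, and the subtrees are then arbitrary decreasing trees whose
  label sets partition \<open>{1..n}\<close>. The set \<open>U\<close> may be empty or everything: there are no trees on the
  empty set, so these choices yield no pair.
\<close>

lemma plane12_trees_Suc:
  "plane12_trees (Suc n) =
     (if n = 0 then {Leaf 1} else {}) \<union> Unary (Suc n) ` plane12_trees n \<union>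
     (\<lambda>(U, l, r). Binary (Suc n) l r) `
       (SIGMA U:Pow {1..n}. trees_on U \<times> trees_on ({1..n} - U))" (is "_ = ?R")
proof (rule set_eqI)
  fix t
  have "{1..Suc n} = insert (Suc n) {1..n}" "Suc n \<notin> {1..n}" by auto
  then have ins: "insert a X = {1..Suc n} \<and> a \<notin> X \<and> a = Suc n \<longleftrightarrow> a = Suc n \<and> X = {1..n}" for a X
    by (metis insert_ident)
  have "t \<in> plane12_trees (Suc n) \<longleftrightarrow> t \<in> plane12_trees (Suc n) \<and> root_label t = Suc n"
    using root_label_plane12_trees by blast
  also have "\<dots> \<longleftrightarrow> t \<in> ?R"
  proof (cases t)
    case (Leaf a)
    then show ?thesis using ins[of a "{}"]
      by (auto simp: plane12_trees_def)
  next
    case (Unary a s)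
    then show ?thesis using ins[of a "set (labels s)"]
      by (auto simp: plane12_trees_def decreasing_iff_less_root simp del: decreasing.simps)
  next
    case (Binary a l r)
    have "t \<in> plane12_trees (Suc n) \<and> root_label t = Suc n \<longleftrightarrow>
        a = Suc n \<and> set (labels l) \<union> set (labels r) = {1..n} \<and>
        decreasing l \<and> decreasing r \<and> distinct (labels l) \<and> distinct (labels r) \<and>
        set (labels l) \<inter> set (labels r) = {}"
    proof -
      have "(\<forall>x\<in>X. x < a) \<and> a \<notin> X \<and> insert a X = {1..Suc n} \<and> a = Suc n \<longleftrightarrow> a = Suc n \<and> X = {1..n}"
        for X using ins[of a X] by auto
      from this[of "set (labels l) \<union> set (labels r)"] show ?thesis
        by (simp only: Binary plane12_trees_def mem_Collect_eq decreasing_iff_less_root labels_simps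
            distinct.simps distinct_append set_append list.set root_label.simps) satx
    qed
    also have "\<dots> \<longleftrightarrow> a = Suc n \<and> (\<exists>U\<in>Pow {1..n}. l \<in> trees_on U \<and> r \<in> trees_on ({1..n} - U))"
    proof -
      have "X \<union> Y = A \<and> X \<inter> Y = {} \<longleftrightarrow> X \<subseteq> A \<and> Y = A - X" for X Y A :: "nat set" by blast
      from this[of "set (labels l)" "set (labels r)" "{1..n}"] show ?thesis
        unfolding trees_on_def by (simp del: One_nat_def) satx
    qed
    also have "\<dots> \<longleftrightarrow> t \<in> ?R"
      by (simp add: Binary image_iff Bex_def split_paired_Ex; blast)
    finally show ?thesis .
  qed
  finally show "t \<in> plane12_trees (Suc n) \<longleftrightarrow> t \<in> ?R" .
qed

text \<open>
  Distinct choices of \<open>U\<close> and of the subtrees give distinct trees, since \<open>U\<close> can be recovered as the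
  label set of the left subtree; hence the decomposition turns sums into iterated sums.
\<close>

lemma sum_plane12_trees_Suc:
  fixes w :: "tree12 \<Rightarrow> 'a::comm_monoid_add"
  shows "sum w (plane12_trees (Suc n)) =
     (if n = 0 then w (Leaf 1) else 0) + (\<Sum>s\<in>plane12_trees n. w (Unary (Suc n) s)) +
     (\<Sum>U\<in>Pow {1..n}. \<Sum>l\<in>trees_on U. \<Sum>r\<in>trees_on ({1..n} - U). w (Binary (Suc n) l r))"
proof -
  let ?I = "SIGMA U:Pow {1..n}. trees_on U \<times> trees_on ({1..n} - U)"
  let ?b = "\<lambda>(U::nat set, l, r). Binary (Suc n) l r"
  have fin: "finite (trees_on U)" "finite (trees_on ({1..n} - U))" if "U \<in> Pow {1..n}" for U
    using that finite_subset by (auto intro!: finite_trees_on)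
  have finI: "finite ?I" using fin by (intro finite_SigmaI finite_cartesian_product) auto
  have inj: "inj_on ?b ?I" by (auto simp: inj_on_def trees_on_def)
  have "sum w (plane12_trees (Suc n)) =
      sum w (if n = 0 then {Leaf 1} else {}) + sum w (Unary (Suc n) ` plane12_trees n) +
      sum w (?b ` ?I)"
    unfolding plane12_trees_Suc
    by (subst sum.union_disjoint; (subst sum.union_disjoint)?)
      (use finI in \<open>auto simp: finite_plane12_trees\<close>)
  also have "sum w (Unary (Suc n) ` plane12_trees n) = (\<Sum>s\<in>plane12_trees n. w (Unary (Suc n) s))"
    by (subst sum.reindex) (auto simp: inj_on_def)
  also have "sum w (?b ` ?I) = (\<Sum>(U, l, r)\<in>?I. w (Binary (Suc n) l r))"
    by (subst sum.reindex[OF inj]) (auto intro: sum.cong)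
  also have "\<dots> = (\<Sum>U\<in>Pow {1..n}. \<Sum>(l, r)\<in>trees_on U \<times> trees_on ({1..n} - U).
      w (Binary (Suc n) l r))"
    using fin by (subst sum.Sigma) auto
  finally show ?thesis by (simp add: sum.cartesian_product)
qed

section \<open>The recurrence\<close>

lemma sum_Pow_card:
  fixes f :: "nat \<Rightarrow> nat"
  assumes "finite A"
  shows "(\<Sum>U\<in>Pow A. f (card U)) = (\<Sum>i\<le>card A. (card A choose i) * f i)"
proof -
  have "(\<Sum>U\<in>Pow A. f (card U)) = (\<Sum>i\<le>card A. \<Sum>U | U \<in> Pow A \<and> card U = i. f (card U))"
    using assms by (intro sum.group[symmetric]) (auto intro: card_mono)
  also have "\<dots> = (\<Sum>i\<le>card A. (card A choose i) * f i)"
    using n_subsets[OF assms] by (intro sum.cong) auto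
  finally show ?thesis .
qed

lemma balanced_count_simps:
  "balanced_count k (Leaf a) = of_bool (balanced (Leaf a) \<and> rank (Leaf a) = k)"
  "balanced_count k (Unary a s) =
     of_bool (balanced (Unary a s) \<and> rank (Unary a s) = k) + balanced_count k s"
  "balanced_count k (Binary a l r) =
     of_bool (balanced (Binary a l r) \<and> rank (Binary a l r) = k) +
     (balanced_count k l + balanced_count k r)"
  by (simp_all add: balanced_count_def)

text \<open>
  The count is split as \<open>b + sub\<close>, the root and the proper descendants. The weight \<open>b\<close> adds up to the
  number of trees with a balanced root of rank \<open>k\<close>. The weight \<open>sub\<close> is additive over the subtrees
  below the root, so its sum factors for each \<open>U\<close>, and the symmetry of \<open>U\<close> and its complement merges
  the contributions of the left and right subtrees.
\<close>

lemma sum_balanced_count_Suc: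
  fixes k n :: nat
  defines "a \<equiv> \<lambda>m. sum (balanced_count k) (plane12_trees m)"
  shows "a (Suc n) = card {t \<in> plane12_trees (Suc n). balanced t \<and> rank t = k} + a n +
     2 * (\<Sum>i\<le>n. (n choose i) * (a i * card (plane12_trees (n - i))))"
proof -
  define b :: "tree12 \<Rightarrow> nat" where "b t = of_bool (balanced t \<and> rank t = k)" for t
  define c where "c m = card (plane12_trees m)" for m
  define sub where "sub t = balanced_count k t - b t" for t
  have sub: "sub (Leaf x) = 0" "sub (Unary x s) = balanced_count k s"
    "sub (Binary x l r) = balanced_count k l + balanced_count k r" for x s l r
    by (simp_all add: sub_def b_def balanced_count_simps)
  have split: "balanced_count k t = b t + sub t" for t
    by (cases t) (simp_all add: sub_def b_def balanced_count_simps)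
  have pair: "(\<Sum>l\<in>trees_on U. \<Sum>r\<in>trees_on ({1..n} - U). balanced_count k l + balanced_count k r)
      = a (card U) * c (n - card U) + a (n - card U) * c (card U)" if "U \<in> Pow {1..n}" for U
  proof -
    have fin: "finite U" "finite ({1..n} - U)"
      using that finite_subset by auto
    have cardU: "card ({1..n} - U) = n - card U"
      using that fin(1) by (subst card_Diff_subset) auto
    show ?thesis
      by (simp add: sum.distrib sum_distrib_left[symmetric] sum_distrib_right[symmetric]
          card_trees_on[OF fin(1)] card_trees_on[OF fin(2)] cardU
          sum_balanced_count_trees_on[OF fin(1)] sum_balanced_count_trees_on[OF fin(2)]
          a_def c_def mult.commute del: One_nat_def)
  qed
  have "sum sub (plane12_trees (Suc n)) = a n +
      (\<Sum>U\<in>Pow {1..n}. a (card U) * c (n - card U) + a (n - card U) * c (card U))"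
    unfolding sum_plane12_trees_Suc sub using pair by (simp add: a_def)
  also have "(\<Sum>U\<in>Pow {1..n}. a (card U) * c (n - card U) + a (n - card U) * c (card U)) =
      (\<Sum>i\<le>n. (n choose i) * (a i * c (n - i))) + (\<Sum>i\<le>n. (n choose i) * (a (n - i) * c i))"
    using sum_Pow_card[of "{1..n}" "\<lambda>i. a i * c (n - i) + a (n - i) * c i"]
    by (simp add: sum.distrib algebra_simps)
  also have "(\<Sum>i\<le>n. (n choose i) * (a (n - i) * c i)) = (\<Sum>i\<le>n. (n choose i) * (a i * c (n - i)))"
    by (rule sum.reindex_bij_witness[of _ "\<lambda>i. n - i" "\<lambda>i. n - i"])
      (auto simp: binomial_symmetric[symmetric])
  finally have "sum sub (plane12_trees (Suc n)) =
      a n + 2 * (\<Sum>i\<le>n. (n choose i) * (a i * c (n - i)))" by simp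
  moreover have "sum b (plane12_trees (Suc n)) =
      card {t \<in> plane12_trees (Suc n). balanced t \<and> rank t = k}"
    by (simp add: b_def finite_plane12_trees Int_def)
  moreover have "a (Suc n) = sum b (plane12_trees (Suc n)) + sum sub (plane12_trees (Suc n))"
    by (simp add: a_def split sum.distrib)
  ultimately show ?thesis by (simp add: c_def)
qed

section \<open>Translation into generating functions\<close>

lemma egf_nth: "fps_nth (egf s) n = real (s n) / fact n"
  by (simp add: egf_def)

lemma fps_deriv_egf: "fps_deriv (egf s) = egf (\<lambda>n. s (Suc n))"
  by (rule fps_ext) (simp add: egf_nth field_simps del: of_nat_Suc)

lemma egf_mult: "egf s * egf t = egf (\<lambda>n. \<Sum>i\<le>n. (n choose i) * (s i * t (n - i)))"
  by (rule fps_ext)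
    (simp add: egf_nth fps_mult_nth binomial_fact sum_divide_distrib atLeast0AtMost)

theorem theorem3p1:
  fixes k :: nat
  shows "fps_deriv (A_egf k) = 2 * A_egf k * Z_egf - A_egf k + fps_deriv (R_egf k)
       \<and> fps_nth (A_egf k) 0 = 0"
proof
  define a where "a m = sum (balanced_count k) (plane12_trees m)" for m
  define r where "r m = card {t \<in> plane12_trees m. balanced t \<and> rank t = k}" for m
  define c where "c m = card (plane12_trees m)" for m
  define z where "z m = (if m = 0 then 1 else c m)" for m
  have egfs: "A_egf k = egf a" "R_egf k = egf r" "Z_egf = egf z"
    unfolding A_egf_def R_egf_def Z_egf_def
    by (intro arg_cong[of _ _ egf] ext; simp add: a_def r_def c_def z_def)+
  show "fps_deriv (A_egf k) = 2 * A_egf k * Z_egf - A_egf k + fps_deriv (R_egf k)"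
  proof (rule fps_ext)
    fix n
    define S where "S = (\<Sum>i\<le>n. (n choose i) * (a i * z (n - i)))"
    have c0: "c 0 = 0" by (simp add: c_def)
    \<comment> \<open>\<open>z\<close> and \<open>c\<close> differ at 0 only, which is reached at \<open>i = n\<close>.\<close>
    have "S = (\<Sum>i\<le>n. (n choose i) * (a i * c (n - i)) + (if i = n then a n else 0))"
      unfolding S_def by (intro sum.cong) (auto simp: z_def c0)
    also have "\<dots> = (\<Sum>i\<le>n. (n choose i) * (a i * c (n - i))) + a n"
      by (simp add: sum.distrib)
    finally have "a (Suc n) + a n = r (Suc n) + 2 * S"
      using sum_balanced_count_Suc[of k n] by (simp add: a_def r_def c_def)
    then have "real (a (Suc n)) = 2 * real S - real (a n) + real (r (Suc n))"
      by linarith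
    moreover have "fps_nth (2 * A_egf k * Z_egf) n = 2 * (real S / fact n)"
    proof -
      have "2 * A_egf k * Z_egf = fps_const 2 * (egf a * egf z)"
        by (simp add: egfs mult.assoc numeral_fps_const)
      then show ?thesis by (simp add: egf_mult egf_nth S_def)
    qed
    ultimately show "fps_nth (fps_deriv (A_egf k)) n =
        fps_nth (2 * A_egf k * Z_egf - A_egf k + fps_deriv (R_egf k)) n"
      by (simp add: egfs fps_deriv_egf egf_nth add_divide_distrib diff_divide_distrib
          del: fps_deriv_nth)
  qed
  show "fps_nth (A_egf k) 0 = 0" by (simp add: egfs egf_nth a_def)
qed

end
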